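(* Let $S$ be a semigroup. Then $S$ is left equalizer simple if and only if the right regular representation of $S$ is a left cancellative semigroup.
   Context: For a semigroup $S$ and a non-empty subset $H\subseteq S$, the left equalizer of $H$ is the set of all $x\in S$ such that $xa=xb$ for all $a,b\in H$. A semigroup $S$ is called left equalizer simple if, for every non-empty subset $H$ of $S$, the left equalizer of $H$ is either empty or equal to $S$; equivalently, for all $a,b\in S$, if $x_0a=x_0b$ for some $x_0\in S$, then $xa=xb$ for all $x\in S$. For $a\in S$ let $\varrho_a$ be the transformation $s\mapsto sa$ of $S$. The map $\varphi: a\mapsto \varrho_a$ is a homomorphism of $S$ into the semigroup of right translations of $S$ (transformations written on the right, so that products are composed from left to right and $\varrho_a\varrho_b=\varrho_{ab}$). Its kernel is the congruence $\theta_S=\{(a,b)\in S\times S: xa=xb \text{ for all } x\in S\}$. The semigroup $\varphi(S)\cong S/\theta_S$ is called the right regular representation of $S$. A semigroup $T$ is left cancellative if, for all $x,a,b\in T$, $xa=xb$ implies $a=b$. *)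

theory Defs
  imports "HOL-Library.FuncSet"
begin

locale carrier_semigroup =
  fixes S :: "'a set" and mul :: "'a \<Rightarrow> 'a \<Rightarrow> 'a"
  assumes closed: "\<lbrakk>a \<in> S; b \<in> S\<rbrakk> \<Longrightarrow> mul a b \<in> S"
    and assoc: "\<lbrakk>a \<in> S; b \<in> S; c \<in> S\<rbrakk> \<Longrightarrow> mul (mul a b) c = mul a (mul b c)"

locale left_cancellative_semigroup = carrier_semigroup +
  assumes left_cancel: "\<lbrakk>x \<in> S; a \<in> S; b \<in> S; mul x a = mul x b\<rbrakk> \<Longrightarrow> a = b"

definition left_equalizer :: "'a set \<Rightarrow> ('a \<Rightarrow> 'a \<Rightarrow> 'a) \<Rightarrow> 'a set \<Rightarrow> 'a set" where
  "left_equalizer S mul H = {x \<in> S. \<forall>a\<in>H. \<forall>b\<in>H. mul x a = mul x b}"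

definition left_equalizer_simple :: "'a set \<Rightarrow> ('a \<Rightarrow> 'a \<Rightarrow> 'a) \<Rightarrow> bool" where
  "left_equalizer_simple S mul \<longleftrightarrow>
     (\<forall>H. H \<subseteq> S \<longrightarrow> H \<noteq> {} \<longrightarrow> left_equalizer S mul H = {} \<or> left_equalizer S mul H = S)"

text \<open>
  A transformation of \<open>S\<close> is represented by a function that is \<^const>\<open>undefined\<close>
  outside \<open>S\<close>, so that equality of such functions is equality of transformations of \<open>S\<close>.
\<close>

definition right_mult :: "'a set \<Rightarrow> ('a \<Rightarrow> 'a \<Rightarrow> 'a) \<Rightarrow> 'a \<Rightarrow> 'a \<Rightarrow> 'a" where
  "right_mult S mul a = (\<lambda>s\<in>S. mul s a)"

text \<open>
  Transformations act on the right: in the product of \<open>f\<close> and \<open>g\<close>, \<open>f\<close> is applied first,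
  whereas \<^term>\<open>compose S g f\<close> maps \<open>s\<close> to \<open>g (f s)\<close>.
\<close>

definition transformation_mul :: "'a set \<Rightarrow> ('a \<Rightarrow> 'a) \<Rightarrow> ('a \<Rightarrow> 'a) \<Rightarrow> 'a \<Rightarrow> 'a" where
  "transformation_mul S f g = compose S g f"

definition right_regular_rep :: "'a set \<Rightarrow> ('a \<Rightarrow> 'a \<Rightarrow> 'a) \<Rightarrow> ('a \<Rightarrow> 'a) set" where
  "right_regular_rep S mul = right_mult S mul ` S"

end

theory Submission
  imports Defs
begin

text \<open>Write \<open>\<theta>\<close> for the kernel of
  \<open>a \<mapsto> right_mult S mul a\<close>. Testing equalizers on pairs shows that
  \<open>S\<close> is left equalizer simple iff \<open>xa = xb\<close> for a single \<open>x\<close>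
  forces \<open>(a, b) \<in> \<theta>\<close> (\<open>left_equalizer_simple_iff\<close>). Since the
  map is a homomorphism, left cancellation in its image says that
  \<open>(xa, xb) \<in> \<theta>\<close> forces \<open>(a, b) \<in> \<theta>\<close>
  (\<open>left_cancellative_right_regular_rep_iff\<close>). The two conditions agree:
  \<open>xa = xb\<close> trivially gives \<open>(xa, xb) \<in> \<theta>\<close>, and conversely
  \<open>(xa, xb) \<in> \<theta>\<close> gives \<open>(xx)a = (xx)b\<close>, an equality at a single
  left factor.\<close>

lemma left_equalizer_simple_iff:
  "left_equalizer_simple S mul \<longleftrightarrow>
    (\<forall>a\<in>S. \<forall>b\<in>S. \<forall>x\<in>S. mul x a = mul x b \<longrightarrow> (\<forall>y\<in>S. mul y a = mul y b))"
    (is "_ \<longleftrightarrow> ?R")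
proof
  assume simple: "left_equalizer_simple S mul"
  show ?R
  proof (intro ballI impI)
    fix a b x y
    assume "a \<in> S" "b \<in> S" and x: "x \<in> S" "mul x a = mul x b" and y: "y \<in> S"
    \<comment> \<open>The pair \<open>{a, b}\<close> is the test set: its equalizer contains
      \<open>x\<close>, so it must be all of \<open>S\<close>.\<close>
    then have "left_equalizer S mul {a, b} = {} \<or> left_equalizer S mul {a, b} = S"
      using simple by (simp add: left_equalizer_simple_def)
    moreover have "x \<in> left_equalizer S mul {a, b}"
      using x by (simp add: left_equalizer_def)
    ultimately have "y \<in> left_equalizer S mul {a, b}"
      using y by auto
    then show "mul y a = mul y b"
      unfolding left_equalizer_def by blast
  qed
next
  assume R: ?R
  show "left_equalizer_simple S mul"
    unfolding left_equalizer_simple_def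
  proof (intro allI impI)
    fix H
    assume H: "H \<subseteq> S"
    \<comment> \<open>One member \<open>x\<close> of the equalizer equates every pair from
      \<open>H\<close>, and \<open>?R\<close> carries each of these equalities to every
      \<open>y\<close> in \<open>S\<close>.\<close>
    have subset: "S \<subseteq> left_equalizer S mul H" if "x \<in> left_equalizer S mul H" for x
    proof
      fix y
      assume y: "y \<in> S"
      have "mul y a = mul y b" if "a \<in> H" "b \<in> H" for a b
      proof -
        have "a \<in> S" "b \<in> S" "x \<in> S" "mul x a = mul x b"
          using that H \<open>x \<in> left_equalizer S mul H\<close> unfolding left_equalizer_def by blast+
        then show ?thesis
          using R y by blast
      qed
      then show "y \<in> left_equalizer S mul H"
        unfolding left_equalizer_def using y by blast
    qed
    have "left_equalizer S mul H \<subseteq> S"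
      unfolding left_equalizer_def by blast
    with subset show "left_equalizer S mul H = {} \<or> left_equalizer S mul H = S"
      by blast
  qed
qed

text \<open>Both functions are \<open>undefined\<close> outside \<open>S\<close>, so only their
  values on \<open>S\<close> can differ. This identifies the kernel with
  \<open>\<theta>\<close>.\<close>

lemma right_mult_eq_iff:
  "right_mult S mul a = right_mult S mul b \<longleftrightarrow> (\<forall>s\<in>S. mul s a = mul s b)"
  unfolding right_mult_def fun_eq_iff restrict_def by auto

context carrier_semigroup
begin

text \<open>The homomorphism property is associativity, \<open>(sa)b = s(ab)\<close>; applying the
  left factor first keeps the order of the product.\<close>

lemma transformation_mul_right_mult:
  assumes "a \<in> S" "b \<in> S"
  shows "transformation_mul S (right_mult S mul a) (right_mult S mul b) = right_mult S mul (mul a b)"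
  using assms
  by (auto simp: transformation_mul_def right_mult_def compose_def fun_eq_iff closed assoc)

lemma carrier_semigroup_right_regular_rep:
  "carrier_semigroup (right_regular_rep S mul) (transformation_mul S)"
  by unfold_locales
    (auto simp: right_regular_rep_def transformation_mul_right_mult closed assoc)

text \<open>Every element of the image is some \<open>right_mult S mul a\<close> with
  \<open>a\<close> in \<open>S\<close>, so cancellation there can be stated on representatives and
  then translated by the homomorphism property and the kernel.\<close>

lemma left_cancellative_right_regular_rep_iff:
  "left_cancellative_semigroup (right_regular_rep S mul) (transformation_mul S) \<longleftrightarrow>
    (\<forall>x\<in>S. \<forall>a\<in>S. \<forall>b\<in>S. (\<forall>s\<in>S. mul s (mul x a) = mul s (mul x b)) \<longrightarrow>
      (\<forall>s\<in>S. mul s a = mul s b))"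
proof -
  have "left_cancellative_semigroup (right_regular_rep S mul) (transformation_mul S) \<longleftrightarrow>
    (\<forall>x\<in>S. \<forall>a\<in>S. \<forall>b\<in>S.
      transformation_mul S (right_mult S mul x) (right_mult S mul a) =
        transformation_mul S (right_mult S mul x) (right_mult S mul b) \<longrightarrow>
      right_mult S mul a = right_mult S mul b)"
    unfolding left_cancellative_semigroup_def left_cancellative_semigroup_axioms_def
      right_regular_rep_def
    using carrier_semigroup_right_regular_rep[unfolded right_regular_rep_def] by blast
  also have "\<dots> \<longleftrightarrow> (\<forall>x\<in>S. \<forall>a\<in>S. \<forall>b\<in>S.
      right_mult S mul (mul x a) = right_mult S mul (mul x b) \<longrightarrow>
      right_mult S mul a = right_mult S mul b)"
    by (simp add: transformation_mul_right_mult cong: ball_cong)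
  finally show ?thesis
    unfolding right_mult_eq_iff .
qed

end

theorem theorem2p1:
  fixes S :: "'a set" and mul :: "'a \<Rightarrow> 'a \<Rightarrow> 'a"
  assumes "carrier_semigroup S mul"
  shows "left_equalizer_simple S mul \<longleftrightarrow>
    left_cancellative_semigroup (right_regular_rep S mul) (transformation_mul S)"
proof -
  interpret carrier_semigroup S mul by (fact assms)
  show ?thesis
    unfolding left_equalizer_simple_iff left_cancellative_right_regular_rep_iff
  proof (intro iffI ballI impI)
    fix x a b s
    assume simple: "\<forall>a\<in>S. \<forall>b\<in>S. \<forall>x\<in>S. mul x a = mul x b \<longrightarrow> (\<forall>y\<in>S. mul y a = mul y b)"
      and mem: "x \<in> S" "a \<in> S" "b \<in> S" "s \<in> S"
      and eq: "\<forall>s\<in>S. mul s (mul x a) = mul s (mul x b)"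
    \<comment> \<open>Taking \<open>s = x\<close> in \<open>eq\<close> and reassociating yields the
      one left factor \<open>xx\<close> that equates \<open>a\<close> and \<open>b\<close>.\<close>
    have "mul x x \<in> S" "mul (mul x x) a = mul (mul x x) b"
      using eq mem by (simp_all add: assoc closed)
    then show "mul s a = mul s b"
      using simple mem by metis
  next
    fix a b x y
    assume cancel: "\<forall>x\<in>S. \<forall>a\<in>S. \<forall>b\<in>S. (\<forall>s\<in>S. mul s (mul x a) = mul s (mul x b)) \<longrightarrow>
        (\<forall>s\<in>S. mul s a = mul s b)"
      and mem: "a \<in> S" "b \<in> S" "x \<in> S" "y \<in> S" and eq: "mul x a = mul x b"
    have "\<forall>s\<in>S. mul s (mul x a) = mul s (mul x b)"
      by (simp add: eq)
    then show "mul y a = mul y b"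
      using cancel mem by blast
  qed
qed

end
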